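(* Let $G=(V,A)$ be a finite simple graph. If $G$ is not a complete graph and $|V|>4$, then the graph Lie algebra $\mathfrak{g}_G$ over $\mathbb{C}$ is not $2$-rigid.
   Context: All Lie algebras are over $\mathbb{C}$. Let $\mathcal{N}_{n,2}$ be the variety of Lie brackets on $\mathbb{C}^n$ that are nilpotent of step at most 2, i.e. the alternating bilinear maps $\mu:\mathbb{C}^n\times\mathbb{C}^n\to\mathbb{C}^n$ with $\mu(\mu(x,y),z)=0$ for all $x,y,z$ (so $\mu$ is either abelian or 2-step nilpotent); it is an affine algebraic variety inside the space of bilinear maps. The group $GL_n(\mathbb{C})$ acts on $\mathcal{N}_{n,2}$ by change of basis, $(g\cdot\mu)(x,y)=g\,\mu(g^{-1}x,g^{-1}y)$. A bracket $\mu\in\mathcal{N}_{n,2}$ is called $2$-rigid if its $GL_n(\mathbb{C})$-orbit is Zariski open in $\mathcal{N}_{n,2}$. An $n$-dimensional at most 2-step nilpotent Lie algebra is called $2$-rigid if its bracket, written in some (equivalently any) basis as an element of $\mathcal{N}_{n,2}$, is $2$-rigid. Let $G=(V,A)$ be a graph with vertices $V=\{v_1,\dots,v_m\}$ and edges $A\subseteq\{a_{ij}:1\le i<j\le m\}$, where $a_{ij}$ is the edge joining $v_i$ and $v_j$. The graph Lie algebra $\mathfrak{g}_G$ is the $\mathbb{C}$-vector space with basis $V\cup A$ (of dimension $n=|V|+|A|$) and Lie bracket determined by $[v_i,v_j]=a_{ij}$ if $a_{ij}\in A$ and $[v_i,v_j]=0$ otherwise, for $1\le i<j\le m$, extended by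 antisymmetry, with all elements of $A$ central. *)

theory Defs
  imports "HOL-Analysis.Analysis" "HOL-Library.Function_Algebras"
begin

text \<open>
  Here \<open>n\<close> is rendered as \<open>CARD('n)\<close> for a finite index type \<open>'n\<close>, and the space of
  \<open>n\<close>-tuples of complex numbers as \<open>complex^'n\<close>. Linearity over the complex numbers is
  linearity with respect to the scaling \<open>(*s)\<close>; the library predicates \<open>linear\<close> and
  \<open>bilinear\<close> on \<open>complex^'n\<close> would mean linearity over the reals.
\<close>

type_synonym 'n bracket = "complex^'n \<Rightarrow> complex^'n \<Rightarrow> complex^'n"

definition clinear :: "(complex^'n \<Rightarrow> complex^'m) \<Rightarrow> bool" where
  "clinear f \<longleftrightarrow> Vector_Spaces.linear (*s) (*s) f"

definition bilinear_maps :: "('n::finite) bracket set" where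
  "bilinear_maps = {\<mu>. (\<forall>x. clinear (\<lambda>y. \<mu> x y)) \<and> (\<forall>y. clinear (\<lambda>x. \<mu> x y))}"

definition nil2_brackets :: "('n::finite) bracket set" where
  "nil2_brackets = {\<mu> \<in> bilinear_maps. (\<forall>x. \<mu> x x = 0) \<and> (\<forall>x y z. \<mu> (\<mu> x y) z = 0)}"

definition gl_act :: "complex^'n^'n \<Rightarrow> ('n::finite) bracket \<Rightarrow> 'n bracket" where
  "gl_act g \<mu> = (\<lambda>x y. g *v \<mu> (matrix_inv g *v x) (matrix_inv g *v y))"

definition gl_orbit :: "('n::finite) bracket \<Rightarrow> 'n bracket set" where
  "gl_orbit \<mu> = {gl_act g \<mu> | g. invertible g}"


text \<open>The polynomial functions in a family of complex variables indexed by \<open>'k\<close>.\<close>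

inductive polynomial_fun :: "(('k \<Rightarrow> complex) \<Rightarrow> complex) \<Rightarrow> bool" where
  const: "polynomial_fun (\<lambda>c. a)"
| coord: "polynomial_fun (\<lambda>c. c k)"
| add: "polynomial_fun p \<Longrightarrow> polynomial_fun q \<Longrightarrow> polynomial_fun (\<lambda>c. p c + q c)"
| mult: "polynomial_fun p \<Longrightarrow> polynomial_fun q \<Longrightarrow> polynomial_fun (\<lambda>c. p c * q c)"

text \<open>The structure constants are the linear coordinates on the space of bilinear maps.\<close>

definition struct_const :: "('n::finite) bracket \<Rightarrow> 'n \<times> 'n \<times> 'n \<Rightarrow> complex" where
  "struct_const \<mu> = (\<lambda>(i, j, k). \<mu> (axis i 1) (axis j 1) $ k)"

definition zariski_closed :: "('n::finite) bracket set \<Rightarrow> bool" where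
  "zariski_closed Z \<longleftrightarrow>
     (\<exists>P. (\<forall>p\<in>P. polynomial_fun p) \<and>
          Z = {\<mu> \<in> bilinear_maps. \<forall>p\<in>P. p (struct_const \<mu>) = 0})"

definition zariski_open_in :: "('n::finite) bracket set \<Rightarrow> 'n bracket set \<Rightarrow> bool" where
  "zariski_open_in X U \<longleftrightarrow> U \<subseteq> X \<and> (\<exists>Z. zariski_closed Z \<and> X - U = X \<inter> Z)"

definition two_rigid :: "('n::finite) bracket \<Rightarrow> bool" where
  "two_rigid \<mu> \<longleftrightarrow> \<mu> \<in> nil2_brackets \<and> zariski_open_in nil2_brackets (gl_orbit \<mu>)"


text \<open>
  A Lie algebra is given by its carrier \<open>L\<close>, a subspace of an ambient complex vector space with
  scalar multiplication \<open>scl\<close>, and its bracket \<open>br\<close>.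
\<close>

definition lin_comb :: "(complex \<Rightarrow> 'b \<Rightarrow> 'b) \<Rightarrow> ('n \<Rightarrow> 'b) \<Rightarrow> complex^('n::finite) \<Rightarrow> 'b::ab_group_add"
  where "lin_comb scl b x = (\<Sum>i\<in>UNIV. scl (x $ i) (b i))"

definition is_basis_of :: "(complex \<Rightarrow> 'b \<Rightarrow> 'b) \<Rightarrow> 'b set \<Rightarrow> ('n \<Rightarrow> 'b::ab_group_add) \<Rightarrow> bool" where
  "is_basis_of scl L b \<longleftrightarrow>
     inj b \<and> \<not> module.dependent scl (range b) \<and> module.span scl (range b) = L"

definition bracket_in_basis ::
    "(complex \<Rightarrow> 'b \<Rightarrow> 'b) \<Rightarrow> ('b \<Rightarrow> 'b \<Rightarrow> 'b) \<Rightarrow> ('n \<Rightarrow> 'b::ab_group_add) \<Rightarrow> ('n::finite) bracket \<Rightarrow> bool"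
  where
  "bracket_in_basis scl br b \<mu> \<longleftrightarrow>
     (\<forall>x y. br (lin_comb scl b x) (lin_comb scl b y) = lin_comb scl b (\<mu> x y))"

text \<open>
  The type argument only supplies an index type for bases of \<open>L\<close>; the definition is meaningful
  when \<open>CARD('n)\<close> is the dimension of \<open>L\<close>.
\<close>

definition two_rigid_lie_algebra ::
    "('n::finite) itself \<Rightarrow> (complex \<Rightarrow> 'b \<Rightarrow> 'b) \<Rightarrow> 'b::ab_group_add set \<Rightarrow> ('b \<Rightarrow> 'b \<Rightarrow> 'b) \<Rightarrow> bool"
  where
  "two_rigid_lie_algebra (_ :: 'n itself) scl L br \<longleftrightarrow>
     (\<exists>(b :: 'n \<Rightarrow> 'b) (\<mu> :: 'n bracket).
        is_basis_of scl L b \<and> bracket_in_basis scl br b \<mu> \<and> two_rigid \<mu>)"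


definition simple_graph :: "'a set \<Rightarrow> 'a set set \<Rightarrow> bool" where
  "simple_graph V E \<longleftrightarrow> (\<forall>e\<in>E. e \<subseteq> V \<and> card e = 2)"

definition complete_graph :: "'a set \<Rightarrow> 'a set set \<Rightarrow> bool" where
  "complete_graph V E \<longleftrightarrow> E = {e. e \<subseteq> V \<and> card e = 2}"

text \<open>
  The vector space with basis \<open>V \<union> A\<close> (disjoint union) is realised as the complex-valued functions on
  \<open>'a + 'a set\<close> that vanish outside \<open>V <+> A\<close>. The ordering \<open>v\<^sub>1, \<dots>, v\<^sub>m\<close> of the
  vertices, on which the sign of the bracket depends, is that of the linearly ordered type \<open>'a\<close>.
\<close>

type_synonym 'a gvec = "'a + 'a set \<Rightarrow> complex"

definition gscale :: "complex \<Rightarrow> 'a gvec \<Rightarrow> 'a gvec" where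
  "gscale c x = (\<lambda>k. c * x k)"

definition gbasis :: "'a + 'a set \<Rightarrow> 'a gvec" where
  "gbasis k = (\<lambda>l. if l = k then 1 else 0)"

definition graph_space :: "'a set \<Rightarrow> 'a set set \<Rightarrow> 'a gvec set" where
  "graph_space V A = {x. \<forall>k. k \<notin> V <+> A \<longrightarrow> x k = 0}"

fun basis_bracket :: "'a::linorder set set \<Rightarrow> 'a + 'a set \<Rightarrow> 'a + 'a set \<Rightarrow> 'a gvec" where
  "basis_bracket A (Inl u) (Inl w) =
     (if {u, w} \<in> A \<and> u < w then gbasis (Inr {u, w})
      else if {u, w} \<in> A \<and> w < u then - gbasis (Inr {u, w})
      else 0)"
| "basis_bracket A (Inr a) _ = 0"
| "basis_bracket A _ (Inr a) = 0"

definition graph_bracket :: "'a::linorder set \<Rightarrow> 'a set set \<Rightarrow> 'a gvec \<Rightarrow> 'a gvec \<Rightarrow> 'a gvec" where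
  "graph_bracket V A x y =
     (\<Sum>p \<in> V <+> A. \<Sum>q \<in> V <+> A. gscale (x p * y q) (basis_bracket A p q))"

lemma vector_space_gscale: "vector_space gscale"
  by unfold_locales (simp_all add: gscale_def fun_eq_iff algebra_simps)

end

theory Submission
  imports Defs
begin

text \<open>
  A rigid bracket cannot be deformed: if its orbit is Zariski open in the variety, then every line of
  at most 2-step nilpotent brackets through it meets the orbit again at some parameter \<open>t \<noteq> 0\<close>
  (\<open>rigid_meets_line\<close>). So it suffices to find a line through the graph bracket whose other members
  are distinguished from it by an isomorphism invariant.

  The invariant is the dimension of the span of all \<open>x\<close> for which \<open>ad x\<close> has rank at most \<open>d\<close>. In a
  graph Lie algebra \<open>ad x\<close> has rank at least the degree of \<open>v\<close> as soon as the coordinate of \<open>x\<close> at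
  the vertex \<open>v\<close> is nonzero, because the brackets of \<open>x\<close> with the neighbours of \<open>v\<close> are independent
  in the coordinates of the edges at \<open>v\<close>. Hence the span in question is spanned by the edges and the
  vertices of degree at most \<open>d\<close>.

  Let \<open>u\<close> and \<open>w\<close> be distinct non-adjacent vertices and \<open>z\<close> an edge through neither of them. Deform
  the graph bracket by \<open>[u, w] = t z\<close> and take \<open>d\<close> to be the degree of \<open>u\<close>. The rank estimate by
  degrees survives, and for \<open>t \<noteq> 0\<close> every \<open>x\<close> with a nonzero coordinate at \<open>u\<close> even gets rank at
  least \<open>d + 1\<close>, because \<open>[x, w]\<close> now has a nonzero coordinate at \<open>z\<close>. So \<open>u\<close> drops out and the
  dimension decreases (\<open>edge_bracket_not_rigid\<close>).

  A non-complete graph with an edge and more than four vertices always has such a disjoint pair of a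
  non-edge and an edge (\<open>disjoint_nonedge_and_edge\<close>). The graph without edges has the zero bracket,
  whose orbit is a single point; it deforms to a nonzero bracket (\<open>edgeless_bracket_not_rigid\<close>).
\<close>

section \<open>The action of the general linear group on brackets\<close>

lemma matrix_inv_cancel:
  fixes g :: "complex^'n^'n"
  assumes "invertible g"
  shows "matrix_inv g *v (g *v x) = x" "g *v (matrix_inv g *v x) = x" "invertible (matrix_inv g)"
proof -
  have *: "g ** matrix_inv g = mat 1 \<and> matrix_inv g ** g = mat 1"
    unfolding matrix_inv_def by (rule someI_ex) (use assms in \<open>simp add: invertible_def\<close>)
  then show "matrix_inv g *v (g *v x) = x" "g *v (matrix_inv g *v x) = x"
    by (simp_all add: matrix_vector_mul_assoc)
  show "invertible (matrix_inv g)"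
    using * by (auto simp: invertible_def)
qed

lemma gl_act_apply:
  assumes "invertible g"
  shows "gl_act g \<mu> (g *v x) (g *v y) = g *v \<mu> x y"
  by (simp add: gl_act_def matrix_inv_cancel[OF assms])

lemma gl_act_eqI:
  assumes "invertible g" "\<And>x y. \<nu> (g *v x) (g *v y) = g *v \<mu> x y"
  shows "gl_act g \<mu> = \<nu>"
proof (intro ext)
  fix x y
  show "gl_act g \<mu> x y = \<nu> x y"
    using assms(2)[of "matrix_inv g *v x" "matrix_inv g *v y"]
    by (simp add: gl_act_def matrix_inv_cancel[OF assms(1)])
qed

lemma gl_act_mat_1: "gl_act (mat 1) \<mu> = \<mu>"
  by (rule gl_act_eqI) (auto simp: invertible_def intro!: exI[of _ "mat 1"])

lemma gl_act_gl_act: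
  assumes "invertible g" "invertible h"
  shows "gl_act g (gl_act h \<mu>) = gl_act (g ** h) \<mu>"
proof (rule gl_act_eqI[symmetric])
  show "invertible (g ** h)"
    using assms by (rule invertible_mult)
qed (simp add: matrix_vector_mul_assoc[symmetric] gl_act_apply assms)

lemma gl_orbit_gl_act:
  assumes "invertible h"
  shows "gl_orbit (gl_act h \<mu>) = gl_orbit \<mu>"
proof -
  have sub: "gl_orbit (gl_act h \<mu>) \<subseteq> gl_orbit \<mu>" if "invertible h" for h and \<mu> :: "'a bracket"
    using that by (fastforce simp: gl_orbit_def gl_act_gl_act intro: invertible_mult)
  have "gl_act (matrix_inv h) (gl_act h \<mu>) = \<mu>"
    by (rule gl_act_eqI) (simp_all add: matrix_inv_cancel assms gl_act_def)
  then show ?thesis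
    using sub[OF assms, of \<mu>] sub[of "matrix_inv h" "gl_act h \<mu>"] matrix_inv_cancel(3)[OF assms]
    by auto
qed

lemma two_rigid_gl_act:
  assumes "two_rigid \<mu>" "invertible h" "gl_act h \<mu> \<in> nil2_brackets"
  shows "two_rigid (gl_act h \<mu>)"
  using assms by (simp add: two_rigid_def gl_orbit_gl_act)

section \<open>Deformations of a rigid bracket\<close>

lemma polynomial_fun_continuous_on_line:
  assumes "polynomial_fun p"
  shows "isCont (\<lambda>t. p (\<lambda>k. a k + t * b k)) t0"
  using assms by induction (auto intro!: continuous_intros)

text \<open>
  A polynomial that vanishes on the complement of the orbit but not at \<open>\<mu>\<close> is continuous along the
  line, so it stays nonzero at small parameters \<open>t \<noteq> 0\<close>.
\<close>

lemma rigid_meets_line: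
  assumes rigid: "two_rigid \<mu>"
    and nil2: "\<And>t. \<nu> t \<in> nil2_brackets"
    and line: "\<And>t k. struct_const (\<nu> t) k = struct_const \<mu> k + t * b k"
  obtains t where "t \<noteq> 0" "\<nu> t \<in> gl_orbit \<mu>"
proof -
  obtain P where P: "\<forall>p\<in>P. polynomial_fun p"
    and compl: "nil2_brackets - gl_orbit \<mu> =
      nil2_brackets \<inter> {\<mu> \<in> bilinear_maps. \<forall>p\<in>P. p (struct_const \<mu>) = 0}"
    using rigid by (auto simp: two_rigid_def zariski_open_in_def zariski_closed_def)
  have "\<mu> \<in> gl_orbit \<mu>"
    unfolding gl_orbit_def
    by (smt (verit, best) gl_act_mat_1 invertible_def matrix_mul_lid mem_Collect_eq)
  moreover have "\<mu> \<in> nil2_brackets"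
    using rigid by (simp add: two_rigid_def)
  moreover from this have "\<mu> \<in> bilinear_maps"
    by (simp add: nil2_brackets_def)
  ultimately obtain p where p: "p \<in> P" "p (struct_const \<mu>) \<noteq> 0"
    using compl by blast
  have "((\<lambda>t. p (\<lambda>k. struct_const \<mu> k + t * b k)) \<longlongrightarrow> p (struct_const \<mu>)) (at 0)"
    using polynomial_fun_continuous_on_line[where p = p and a = "struct_const \<mu>" and b = b and ?t0.0 = 0] P p(1)
    by (simp add: isCont_def)
  then have "\<forall>\<^sub>F t in at 0. p (struct_const (\<nu> t)) \<noteq> 0"
    using p(2) by (simp add: line[abs_def] tendsto_imp_eventually_ne)
  moreover have "\<forall>\<^sub>F t in at (0::complex). t \<noteq> 0"
    by (rule eventually_neq_at_within)
  ultimately have "\<forall>\<^sub>F t in at 0. t \<noteq> 0 \<and> p (struct_const (\<nu> t)) \<noteq> 0"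
    by eventually_elim simp
  then obtain t where "t \<noteq> 0" "p (struct_const (\<nu> t)) \<noteq> 0"
    using eventually_happens'[OF at_neq_bot] by blast
  moreover from this have "\<nu> t \<in> gl_orbit \<mu>"
    using compl p(1) nil2[of t] by blast
  ultimately show ?thesis
    using that by blast
qed

section \<open>Elements of small adjoint rank\<close>

text \<open>
  The rank of \<open>ad x\<close> is measured by the dimension of the span of the image \<open>range (\<mu> x)\<close>, and
  for bilinear \<open>\<mu>\<close> the set \<open>low_rank \<mu> d\<close> is a cone, usually not a subspace; its \<open>vec.dim\<close> is the
  dimension of its span.
\<close>

definition low_rank :: "'n::finite bracket \<Rightarrow> nat \<Rightarrow> (complex^'n) set" where
  "low_rank \<mu> d = {x. vec.dim (range (\<mu> x)) \<le> d}"

lemma dim_matrix_image: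
  fixes g :: "complex^'n^'n"
  assumes "invertible g"
  shows "vec.dim ((*v) g ` S) = vec.dim S"
proof (rule vec.dim_image_eq)
  show "inj_on ((*v) g) (vec.span S)"
    by (rule inj_on_inverseI) (rule matrix_inv_cancel(1)[OF assms])
qed simp

text \<open>
  The matrix \<open>g\<close> is an isomorphism from \<open>\<mu>\<close> to \<open>gl_act g \<mu>\<close>, so it carries the elements of adjoint
  rank at most \<open>d\<close> of the one bracket onto those of the other.
\<close>

lemma dim_low_rank_gl_act:
  assumes "invertible g"
  shows "vec.dim (low_rank (gl_act g \<mu>) d) = vec.dim (low_rank \<mu> d)"
proof -
  have range: "range (gl_act g \<mu> (g *v x)) = (*v) g ` range (\<mu> x)" for x
  proof -
    have "surj ((*v) g)"
      by (rule surjI) (rule matrix_inv_cancel(2)[OF assms])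
    then have "range (gl_act g \<mu> (g *v x)) = gl_act g \<mu> (g *v x) ` range ((*v) g)"
      by simp
    also have "\<dots> = (*v) g ` range (\<mu> x)"
      by (simp only: image_image gl_act_apply[OF assms])
    finally show ?thesis .
  qed
  have "low_rank (gl_act g \<mu>) d = (*v) g ` low_rank \<mu> d"
  proof (intro set_eqI iffI)
    fix x assume "x \<in> low_rank (gl_act g \<mu>) d"
    then have "matrix_inv g *v x \<in> low_rank \<mu> d"
      using range[of "matrix_inv g *v x"]
      by (simp add: low_rank_def dim_matrix_image[OF assms] matrix_inv_cancel[OF assms])
    then show "x \<in> (*v) g ` low_rank \<mu> d"
      by (metis imageI matrix_inv_cancel(2)[OF assms])
  qed (auto simp: low_rank_def range dim_matrix_image[OF assms])
  then show ?thesis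
    by (simp add: dim_matrix_image[OF assms])
qed

lemma dim_le_card_support:
  fixes S :: "(complex^'n) set"
  assumes "\<And>y k. y \<in> S \<Longrightarrow> k \<notin> K \<Longrightarrow> y $ k = 0"
  shows "vec.dim S \<le> card K"
proof -
  have "y \<in> vec.span ((\<lambda>k. axis k 1) ` K)" if "y \<in> S" for y
  proof -
    have "y = (\<Sum>k\<in>UNIV. y $ k *s axis k 1)"
      by (simp add: basis_expansion)
    also have "\<dots> = (\<Sum>k\<in>K. y $ k *s axis k 1)"
      by (rule sum.mono_neutral_right) (use assms that in auto)
    also have "\<dots> \<in> vec.span ((\<lambda>k. axis k 1) ` K)"
      by (intro vec.span_sum vec.span_scale vec.span_base imageI)
    finally show ?thesis .
  qed
  then have "vec.dim S \<le> card ((\<lambda>k. axis k (1::complex) :: complex^'n) ` K)"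
    by (intro vec.dim_le_card) auto
  also have "\<dots> \<le> card K"
    by (rule card_image_le) simp
  finally show ?thesis .
qed

text \<open>
  The vectors \<open>f k\<close> form a matrix that is diagonal on the columns \<open>K\<close> except for the one column \<open>z\<close>.
  In a vanishing linear combination the other columns kill all coefficients but that of \<open>f z\<close>, and
  then column \<open>z\<close> kills the last one. The exceptional column leaves room for a deformation in the
  direction of \<open>z\<close>.
\<close>

lemma card_le_dim_triangular:
  fixes S :: "(complex^'n) set"
  assumes f: "\<And>k. k \<in> K \<Longrightarrow> f k \<in> S"
    and diag: "\<And>k. k \<in> K \<Longrightarrow> f k $ k \<noteq> 0"
    and off: "\<And>k k'. k \<in> K \<Longrightarrow> k' \<in> K \<Longrightarrow> k \<noteq> k' \<Longrightarrow> k' \<noteq> z \<Longrightarrow> f k $ k' = 0"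
  shows "card K \<le> vec.dim S"
proof -
  have inj: "inj_on f K"
    by (rule inj_onI) (metis diag off)
  have "vec.independent (f ` K)"
  proof (rule vec.independent_if_scalars_zero)
    fix a x assume sum0: "(\<Sum>x\<in>f ` K. a x *s x) = 0" and "x \<in> f ` K"
    then obtain k where k: "k \<in> K" "x = f k"
      by blast
    have comb: "(\<Sum>k\<in>K. a (f k) * f k $ j) = 0" for j
    proof -
      have "(\<Sum>k\<in>K. a (f k) *s f k) $ j = 0"
        using sum0 by (simp add: sum.reindex[OF inj])
      then show ?thesis
        by simp
    qed
    have zero: "a (f j) = 0" if "j \<in> K" "j \<noteq> z" for j
    proof -
      have "(\<Sum>k\<in>K. a (f k) * f k $ j) = (\<Sum>k\<in>{j}. a (f k) * f k $ j)"
        by (rule sum.mono_neutral_right) (use off that in auto)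
      then show ?thesis
        using comb[of j] diag[OF that(1)] by simp
    qed
    have "a (f z) = 0" if "z \<in> K"
    proof -
      have "(\<Sum>k\<in>K. a (f k) * f k $ z) = (\<Sum>k\<in>{z}. a (f k) * f k $ z)"
        by (rule sum.mono_neutral_right) (use zero that in auto)
      then show ?thesis
        using comb[of z] diag[OF that] by simp
    qed
    then show "a x = 0"
      using zero k by metis
  qed simp
  then have "card (f ` K) \<le> vec.dim S"
    using f by (intro vec.independent_card_le_dim) auto
  then show ?thesis
    by (simp add: card_image[OF inj])
qed

section \<open>Graph brackets in coordinates\<close>

lemma axis_nth_if: "axis i a $ j = (if i = j then a else 0)"
  by (simp add: axis_def)

text \<open>
  A graph on a set of indices: the indices in \<open>E\<close> stand for the edges, the others for the vertices,
  and \<open>s k\<close>, \<open>r k\<close> are the end points of the edge \<open>k\<close>, in the order that fixes the sign.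
\<close>

definition edge_bracket :: "'n set \<Rightarrow> ('n \<Rightarrow> 'n) \<Rightarrow> ('n \<Rightarrow> 'n) \<Rightarrow> 'n::finite bracket" where
  "edge_bracket E s r x y = (\<chi> k. if k \<in> E then x $ s k * y $ r k - x $ r k * y $ s k else 0)"

text \<open>The deformation adds the relation \<open>[u, w] = t z\<close>.\<close>

definition deformed_bracket ::
    "'n set \<Rightarrow> ('n \<Rightarrow> 'n) \<Rightarrow> ('n \<Rightarrow> 'n) \<Rightarrow> 'n \<Rightarrow> 'n \<Rightarrow> 'n \<Rightarrow> complex \<Rightarrow> 'n::finite bracket" where
  "deformed_bracket E s r u w z t x y =
     edge_bracket E s r x y + (t * (x $ u * y $ w - x $ w * y $ u)) *s axis z 1"

lemma deformed_bracket_nth: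
  "deformed_bracket E s r u w z t x y $ k =
     (if k \<in> E then x $ s k * y $ r k - x $ r k * y $ s k else 0) +
     (if k = z then t * (x $ u * y $ w - x $ w * y $ u) else 0)"
  by (simp add: deformed_bracket_def edge_bracket_def axis_nth_if)

lemma deformed_bracket_0: "deformed_bracket E s r u w z 0 = edge_bracket E s r"
  by (simp add: deformed_bracket_def fun_eq_iff)

text \<open>
  A bracket has nonzero coordinates only at indices in \<open>insert z E\<close>, and it depends only on the
  coordinates of its arguments outside this set; so iterated brackets vanish.
\<close>

lemma deformed_bracket_nil2:
  assumes ends: "\<And>k. k \<in> E \<Longrightarrow> s k \<notin> insert z E \<and> r k \<notin> insert z E"
    and uw: "u \<notin> insert z E" "w \<notin> insert z E"
  shows "deformed_bracket E s r u w z t \<in> nil2_brackets"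
proof -
  let ?\<nu> = "deformed_bracket E s r u w z t"
  have "clinear (?\<nu> x)" for x
    unfolding clinear_def
    by unfold_locales (simp_all add: vec_eq_iff deformed_bracket_nth algebra_simps)
  moreover have "clinear (\<lambda>x. ?\<nu> x y)" for y
    unfolding clinear_def
    by unfold_locales (simp_all add: vec_eq_iff deformed_bracket_nth algebra_simps)
  moreover have "?\<nu> x x = 0" for x
    by (simp add: vec_eq_iff deformed_bracket_nth)
  moreover have "?\<nu> x y $ k = 0" if "k \<notin> insert z E" for x y k
    using that by (simp add: deformed_bracket_nth)
  then have "?\<nu> (?\<nu> x y) v $ k = 0" for x y v k
    unfolding deformed_bracket_nth[of _ _ _ _ _ _ _ "?\<nu> x y" v] using ends uw by simp
  then have "?\<nu> (?\<nu> x y) v = 0" for x y v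
    by (simp add: vec_eq_iff)
  ultimately show ?thesis
    by (simp add: nil2_brackets_def bilinear_maps_def)
qed

lemma edge_bracket_nil2:
  assumes "\<And>k. k \<in> E \<Longrightarrow> s k \<notin> E \<and> r k \<notin> E"
  shows "edge_bracket E s r \<in> nil2_brackets"
proof (cases "E = {}")
  case True
  then have "edge_bracket E s r = (\<lambda>x y. 0)"
    by (simp add: edge_bracket_def fun_eq_iff vec_eq_iff)
  then show ?thesis
    by (simp add: nil2_brackets_def bilinear_maps_def clinear_def vec.linear_zero)
next
  case False
  then obtain z where "z \<in> E"
    by blast
  then have "insert z E = E"
    by blast
  then show ?thesis
    using deformed_bracket_nil2[of E s z r "s z" "s z" 0] assms \<open>z \<in> E\<close>
    by (simp add: deformed_bracket_0)
qed

lemma rigid_edge_bracket_meets_deformation: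
  assumes "two_rigid (edge_bracket E s r)"
    and "\<And>k. k \<in> E \<Longrightarrow> s k \<notin> insert z E \<and> r k \<notin> insert z E"
    and "u \<notin> insert z E" "w \<notin> insert z E"
  obtains t g where "t \<noteq> 0" "invertible g"
    "deformed_bracket E s r u w z t = gl_act g (edge_bracket E s r)"
proof -
  have line: "struct_const (deformed_bracket E s r u w z t) k = struct_const (edge_bracket E s r) k +
      t * (case k of (i, j, k) \<Rightarrow>
        (axis i 1 $ u * axis j 1 $ w - axis i 1 $ w * axis j 1 $ u) * axis z 1 $ k)" for t k
    by (cases k) (simp add: struct_const_def deformed_bracket_def)
  show ?thesis
    using rigid_meets_line[OF assms(1) deformed_bracket_nil2[OF assms(2-4)] line] that
    unfolding gl_orbit_def by (smt (verit) mem_Collect_eq)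
qed

section \<open>Non-rigidity\<close>

lemma edgeless_bracket_not_rigid:
  fixes E :: "'n::finite set"
  assumes "E = {}" and "CARD('n) > 2"
  shows "\<not> two_rigid (edge_bracket E s r)"
proof
  assume rigid: "two_rigid (edge_bracket E s r)"
  obtain S :: "'n set" where "card S = 3"
    using obtain_subset_with_card_n[of 3 "UNIV :: 'n set"] assms(2) by auto
  then obtain u w z :: 'n where uwz: "u \<noteq> w" "u \<noteq> z" "w \<noteq> z"
    by (auto simp: card_3_iff)
  obtain t g where t: "t \<noteq> 0"
    and g: "deformed_bracket E s r u w z t = gl_act g (edge_bracket E s r)"
    by (rule rigid_edge_bracket_meets_deformation[OF rigid, of z u w]) (use assms(1) uwz in auto)
  have "edge_bracket E s r = (\<lambda>x y. 0)"
    using assms(1) by (simp add: edge_bracket_def fun_eq_iff vec_eq_iff)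
  then have "gl_act g (edge_bracket E s r) (axis u 1) (axis w 1) = 0"
    by (simp add: gl_act_def)
  moreover have "deformed_bracket E s r u w z t (axis u 1) (axis w 1) $ z = t"
    using assms(1) uwz by (simp add: deformed_bracket_nth axis_nth_if)
  ultimately show False
    using t g by simp
qed

text \<open>
  With \<open>d\<close> the degree of \<open>u\<close>, the elements of adjoint rank at most \<open>d\<close> span at least the basis
  vectors of degree at most \<open>d\<close> before the deformation, and at most those other than \<open>u\<close> after it.
  Edges are central, so as indices they count as having degree 0; this spares a distinction between
  vertices and edges.
\<close>

lemma edge_bracket_not_rigid:
  fixes E :: "'n::finite set"
  assumes ends: "\<And>k. k \<in> E \<Longrightarrow> s k \<noteq> r k \<and> s k \<notin> E \<and> r k \<notin> E"
    and simple: "\<And>k k'. k \<in> E \<Longrightarrow> k' \<in> E \<Longrightarrow> {s k, r k} = {s k', r k'} \<Longrightarrow> k = k'"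
    and uw: "u \<noteq> w" "u \<notin> E" "w \<notin> E" and nonedge: "\<And>k. k \<in> E \<Longrightarrow> {s k, r k} \<noteq> {u, w}"
    and z: "z \<in> E" "{s z, r z} \<inter> {u, w} = {}"
  shows "\<not> two_rigid (edge_bracket E s r)"
proof
  assume rigid: "two_rigid (edge_bracket E s r)"
  have "insert z E = E"
    using z(1) by blast
  then obtain t g where t: "t \<noteq> 0" and g: "invertible g"
      and eq: "deformed_bracket E s r u w z t = gl_act g (edge_bracket E s r)"
    using rigid_edge_bracket_meets_deformation[OF rigid, of z u w] ends uw by metis
  let ?\<mu> = "edge_bracket E s r" and ?\<nu> = "deformed_bracket E s r u w z t"
  define inc where "inc v = {k \<in> E. s k = v \<or> r k = v}" for v
  define opp where "opp v k = (if s k = v then r k else s k)" for v k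
  define d where "d = card (inc u)"
  define T where "T = {v. card (inc v) \<le> d}"

  have opp: "{s k, r k} = {v, opp v k}" "opp v k \<noteq> v" if "k \<in> inc v" for v k
    using that ends[of k] by (auto simp: inc_def opp_def)
  have opp_inj: "k = k'" if "k \<in> inc v" "k' \<in> inc v" "opp v k = opp v k'" for v k k'
    using that opp(1)[of k v] opp(1)[of k' v] simple[of k k'] by (simp add: inc_def)

  have T_low: "axis v 1 \<in> low_rank ?\<mu> d" if "v \<in> T" for v
  proof -
    have "vec.dim (range (?\<mu> (axis v 1))) \<le> card (inc v)"
      by (rule dim_le_card_support) (auto simp: edge_bracket_def axis_nth_if inc_def)
    then show ?thesis
      using that by (simp add: low_rank_def T_def)
  qed
  have lower: "card T \<le> vec.dim (low_rank ?\<mu> d)"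
  proof (rule card_le_dim_triangular)
    show "axis v 1 $ v' = (0::complex)" if "v \<noteq> v'" for v v' :: 'n
      using that by (simp add: axis_nth_if)
  qed (simp_all add: T_low)

  \<comment> \<open>The rows are the brackets of \<open>x\<close> with the neighbours of \<open>v\<close>, the columns the edges at \<open>v\<close>. The
    deformation contributes only to column \<open>z\<close> and, as \<open>z\<close> avoids \<open>u\<close> and \<open>w\<close>, not to its diagonal
    entry.\<close>
  have row_diag: "?\<nu> x (axis (opp v k) 1) $ k \<noteq> 0" if "x $ v \<noteq> 0" "k \<in> inc v" for x v k
  proof -
    have "opp v k \<noteq> u \<and> opp v k \<noteq> w" if "k = z"
      using that z(2) opp(1)[OF \<open>k \<in> inc v\<close>] by auto
    then have "?\<nu> x (axis (opp v k) 1) $ k =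
        (if s k = v then x $ v else - x $ v)"
      using \<open>k \<in> inc v\<close> ends[of k] by (auto simp: deformed_bracket_nth axis_nth_if inc_def opp_def)
    then show ?thesis
      using that by simp
  qed
  have row_off: "?\<nu> x (axis (opp v k) 1) $ k' = 0"
    if "k \<in> inc v" "k' \<in> inc v" "k \<noteq> k'" "k' \<noteq> z" for x v k k'
  proof -
    have "opp v k \<notin> {s k', r k'}"
      using that opp(1)[of k' v] opp(2)[of k v] opp_inj[of k v k'] by auto
    then show ?thesis
      using that by (auto simp: deformed_bracket_nth axis_nth_if)
  qed

  have rank_ge: "card (inc v) \<le> vec.dim (range (?\<nu> x))" if "x $ v \<noteq> 0" for x v
    by (rule card_le_dim_triangular[where f = "\<lambda>k. ?\<nu> x (axis (opp v k) 1)" and z = z])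
      (use row_diag row_off that in auto)
  have z_inc: "z \<notin> inc u"
    using z by (auto simp: inc_def)
  \<comment> \<open>For \<open>v = u\<close> the deformation supplies one more row, \<open>[x, w]\<close>. It vanishes at the edges of \<open>u\<close>
    because none of them ends in \<open>w\<close>.\<close>
  have w_row: "?\<nu> x (axis w 1) $ z = t * x $ u" for x
    using z uw by (auto simp: deformed_bracket_nth axis_nth_if)
  have w_row_off: "?\<nu> x (axis w 1) $ k = 0" if "k \<in> inc u" for x k
  proof -
    have "w \<notin> {s k, r k}"
      using that opp(1)[OF that] nonedge[of k] uw by (auto simp: inc_def)
    then show ?thesis
      using that z_inc by (auto simp: deformed_bracket_nth axis_nth_if)
  qed
  have rank_gt: "d < vec.dim (range (?\<nu> x))" if "x $ u \<noteq> 0" for x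
  proof -
    have "card (insert z (inc u)) \<le> vec.dim (range (?\<nu> x))"
      by (rule card_le_dim_triangular[where z = z
            and f = "\<lambda>k. if k = z then ?\<nu> x (axis w 1) else ?\<nu> x (axis (opp u k) 1)"])
        (use row_diag row_off w_row w_row_off that t in auto)
    then show ?thesis
      using z_inc by (simp add: d_def)
  qed
  have upper: "vec.dim (low_rank ?\<nu> d) \<le> card (T - {u})"
  proof (rule dim_le_card_support)
    fix x v assume x: "x \<in> low_rank ?\<nu> d" and v: "v \<notin> T - {u}"
    show "x $ v = 0"
    proof (rule ccontr)
      assume "x $ v \<noteq> 0"
      then have "d < vec.dim (range (?\<nu> x))"
        using v rank_ge[of x v] rank_gt[of x] by (cases "v = u") (auto simp: T_def)
      then show False
        using x by (simp add: low_rank_def)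
    qed
  qed
  have "card (T - {u}) < card T"
    by (rule card_Diff1_less) (auto simp: T_def d_def)
  then show False
    using lower upper dim_low_rank_gl_act[OF g, of ?\<mu> d] eq by simp
qed

section \<open>Graph Lie algebras\<close>

text \<open>
  If some edge and some non-edge meet, they cover at most three vertices, so two further vertices
  remain. This third pair is disjoint from both: it pairs with the non-edge if it is an edge, and with
  the edge if it is not.
\<close>

lemma disjoint_nonedge_and_edge:
  assumes "simple_graph V A" "\<not> complete_graph V A" "card V > 4" "A \<noteq> {}"
  obtains u w e where "u \<in> V" "w \<in> V" "u \<noteq> w" "{u, w} \<notin> A" "e \<in> A" "e \<inter> {u, w} = {}"
proof -
  have finV: "finite V"
    using assms(3) card.infinite by fastforce
  have A: "e \<subseteq> V \<and> card e = 2" if "e \<in> A" for e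
    using assms(1) that by (simp add: simple_graph_def)
  obtain f where f: "f \<subseteq> V" "card f = 2" "f \<notin> A"
    using assms(1,2) by (auto simp: simple_graph_def complete_graph_def)
  obtain e0 where e0: "e0 \<in> A"
    using assms(4) by blast
  have disj: "\<exists>f e. f \<subseteq> V \<and> card f = 2 \<and> f \<notin> A \<and> e \<in> A \<and> e \<inter> f = {}"
  proof (cases "e0 \<inter> f = {}")
    case True
    then show ?thesis
      using e0 f by blast
  next
    case False
    have fin: "finite e0" "finite f"
      using A[OF e0] f(1) finV finite_subset by auto
    have "card (e0 \<union> f) + card (e0 \<inter> f) = 4"
      using card_Un_Int[OF fin] A[OF e0] f(2) by simp
    moreover have "card (e0 \<inter> f) > 0"
      using False fin by (simp add: card_gt_0_iff)
    ultimately have "card (e0 \<union> f) \<le> 3"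
      by linarith
    moreover have "card (V - (e0 \<union> f)) \<ge> card V - card (e0 \<union> f)"
      by (rule diff_card_le_card_Diff) (use fin in simp)
    ultimately have "card (V - (e0 \<union> f)) \<ge> 2"
      using assms(3) by linarith
    then obtain h where h: "h \<subseteq> V - (e0 \<union> f)" "card h = 2"
      by (rule obtain_subset_with_card_n)
    show ?thesis
    proof (cases "h \<in> A")
      case True
      then show ?thesis
        using h(1) f by (intro exI[of _ f] exI[of _ h]) auto
    next
      case False
      then show ?thesis
        using h e0 by (intro exI[of _ h] exI[of _ e0]) auto
    qed
  qed
  then obtain f e where f: "f \<subseteq> V" "card f = 2" "f \<notin> A" and e: "e \<in> A" "e \<inter> f = {}"
    by blast
  then obtain u w where "f = {u, w}" "u \<noteq> w"
    by (auto simp: card_2_iff)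
  then show ?thesis
    using that f e by blast
qed

lemma sum_fun_apply: "(\<Sum>i\<in>I. F i) k = (\<Sum>i\<in>I. F i k)"
  by (induction I rule: infinite_finite_induct) auto

lemma graph_bracket_apply:
  fixes V :: "'a::linorder set"
  assumes "finite V" "simple_graph V A"
  shows "graph_bracket V A x y (Inl v) = 0"
    and "e \<in> A \<Longrightarrow> e = {a, c} \<Longrightarrow> a < c \<Longrightarrow>
      graph_bracket V A x y (Inr e) = x (Inl a) * y (Inl c) - x (Inl c) * y (Inl a)"
proof -
  have expand: "graph_bracket V A x y k =
      (\<Sum>p\<in>V <+> A. \<Sum>q\<in>V <+> A. x p * y q * basis_bracket A p q k)" for k
    by (simp add: graph_bracket_def sum_fun_apply gscale_def)
  have "basis_bracket A p q (Inl v) = 0" for p q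
    by (cases "(A, p, q)" rule: basis_bracket.cases) (auto simp: gbasis_def)
  then show "graph_bracket V A x y (Inl v) = 0"
    by (simp add: expand)
  assume e: "e \<in> A" "e = {a, c}" "a < c"
  have fin: "finite (V <+> A)"
    using assms finite_subset[of A "Pow V"] by (auto simp: simple_graph_def)
  have in_V: "Inl a \<in> V <+> A" "Inl c \<in> V <+> A"
    using assms(2) e by (auto simp: simple_graph_def)
  have ac: "basis_bracket A p q (Inr e) = (if p = Inl a \<and> q = Inl c then 1
      else if p = Inl c \<and> q = Inl a then - 1 else 0)" for p q
  proof (cases "\<exists>u w. p = Inl u \<and> q = Inl w")
    case True
    then obtain u w where pq: "p = Inl u" "q = Inl w"
      by blast
    consider "u = a" "w = c" | "u = c" "w = a" | "e \<noteq> {u, w}" "\<not> (u = a \<and> w = c)" "\<not> (u = c \<and> w = a)"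
      unfolding e(2) doubleton_eq_iff by blast
    then show ?thesis
    proof cases
      case 1
      then show ?thesis
        using e(1,3) unfolding pq by (simp add: gbasis_def flip: e(2))
    next
      case 2
      have "{c, a} = e"
        unfolding e(2) by (rule insert_commute)
      then have "basis_bracket A (Inl c) (Inl a) = - gbasis (Inr e)"
        using e(1) e(3) less_not_sym[OF e(3)] unfolding basis_bracket.simps
        by (simp only: if_True if_False simp_thms)
      then show ?thesis
        using 2 e(3) unfolding pq by (simp add: gbasis_def)
    next
      case 3
      then have "basis_bracket A (Inl u) (Inl w) (Inr e) = 0"
        by (simp add: gbasis_def)
      then show ?thesis
        using 3(2,3) unfolding pq sum.inject by (simp only: if_False)
    qed
  next
    case False
    then have "basis_bracket A p q = 0"
      by (cases p; cases q) simp_all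
    then show ?thesis
      using False by auto
  qed
  have "graph_bracket V A x y (Inr e) = (\<Sum>p\<in>V <+> A. \<Sum>q\<in>V <+> A.
      (if q = Inl c then if p = Inl a then x p * y q else 0 else 0) -
      (if q = Inl a then if p = Inl c then x p * y q else 0 else 0))"
    unfolding expand ac by (intro sum.cong refl) (use e(3) in auto)
  also have "\<dots> = x (Inl a) * y (Inl c) - x (Inl c) * y (Inl a)"
    using in_V by (simp only: sum_subtractf sum.delta[OF fin] if_True)
  finally show "graph_bracket V A x y (Inr e) = x (Inl a) * y (Inl c) - x (Inl c) * y (Inl a)" .
qed

text \<open>
  Rigidity speaks of the bracket in some basis \<open>b\<close>. Passing to the basis of vertices and edges,
  indexed by \<open>\<beta>\<close>, is the action of the matrix whose columns are the coordinates of the vectors of \<open>b\<close>;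
  \<open>F\<close> is the graph bracket in these new coordinates.
\<close>

lemma graph_bracket_in_coordinates:
  fixes V :: "'a::linorder set" and \<beta> :: "'n::finite \<Rightarrow> 'a + 'a set"
  assumes \<beta>: "bij_betw \<beta> UNIV (V <+> A)"
    and b: "is_basis_of gscale (graph_space V A) b"
    and \<mu>: "bracket_in_basis gscale (graph_bracket V A) b \<mu>"
    and F: "\<And>x y i. F (\<chi> i. x (\<beta> i)) (\<chi> i. y (\<beta> i)) $ i = graph_bracket V A x y (\<beta> i)"
  obtains Q where "invertible Q" "F = gl_act Q \<mu>"
proof
  interpret gs: vector_space gscale
    by (rule vector_space_gscale)
  define Q :: "complex^'n^'n" where "Q = (\<chi> i j. b j (\<beta> i))"
  have inj: "inj b" and indep: "gs.independent (range b)" and span: "gs.span (range b) = graph_space V A"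
    using b by (auto simp: is_basis_of_def)
  have lc: "lin_comb gscale b x k = (\<Sum>j\<in>UNIV. x $ j * b j k)" for x k
    by (simp add: lin_comb_def sum_fun_apply gscale_def)
  have Q: "Q *v x = (\<chi> i. lin_comb gscale b x (\<beta> i))" for x
    by (simp add: lc Q_def matrix_vector_mult_def mult.commute)
  have outside: "lin_comb gscale b x k = 0" if "k \<notin> V <+> A" for x k
  proof -
    have "b j \<in> graph_space V A" for j
      using gs.span_base[of "b j" "range b"] span by simp
    then show ?thesis
      using that by (simp add: lc graph_space_def)
  qed
  have "x = 0" if "Q *v x = 0" for x
  proof -
    have "lin_comb gscale b x k = 0" for k
    proof (cases "k \<in> V <+> A")
      case True
      then obtain i where "k = \<beta> i"
        using \<beta> by (auto simp: bij_betw_def)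
      then show ?thesis
        using that by (simp add: Q vec_eq_iff)
    qed (rule outside)
    then have "(\<Sum>v\<in>range b. gscale (x $ inv b v) v) = 0"
      by (simp add: sum.reindex[OF inj] inv_f_f[OF inj] lin_comb_def fun_eq_iff)
    then have "x $ inv b (b j) = 0" for j
      by (intro gs.independentD[OF indep, of "range b"]) auto
    then show ?thesis
      by (simp add: vec_eq_iff inv_f_f[OF inj])
  qed
  then show "invertible Q"
    by (simp add: invertible_left_inverse matrix_left_invertible_ker)
  then show "F = gl_act Q \<mu>"
  proof (rule gl_act_eqI[symmetric])
    fix x y
    show "F (Q *v x) (Q *v y) = Q *v \<mu> x y"
      using \<mu> by (simp add: vec_eq_iff Q F bracket_in_basis_def)
  qed
qed

theorem theorem3p4:
  fixes V :: "'a::linorder set" and A :: "'a set set"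
  assumes "finite V"
    and "simple_graph V A"
    and "\<not> complete_graph V A"
    and "card V > 4"
    and "CARD('n::finite) = card V + card A"
  shows "\<not> two_rigid_lie_algebra TYPE('n) gscale (graph_space V A) (graph_bracket V A)"
proof
  assume "two_rigid_lie_algebra TYPE('n) gscale (graph_space V A) (graph_bracket V A)"
  then obtain b :: "'n \<Rightarrow> 'a gvec" and \<mu>
    where basis: "is_basis_of gscale (graph_space V A) b"
      "bracket_in_basis gscale (graph_bracket V A) b \<mu>" and rigid: "two_rigid \<mu>"
    unfolding two_rigid_lie_algebra_def by blast
  have A: "e \<subseteq> V \<and> card e = 2" if "e \<in> A" for e
    using assms(2) that by (simp add: simple_graph_def)
  have finA: "finite A"
    using A assms(1) by (meson PowI finite_Pow_iff finite_subset subsetI)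
  obtain \<beta> :: "'n \<Rightarrow> 'a + 'a set" where \<beta>: "bij_betw \<beta> UNIV (V <+> A)"
    using finite_same_card_bij[of "UNIV :: 'n set" "V <+> A"] assms(1,5) finA
    by (auto simp: card_Plus)
  define \<iota> where "\<iota> = inv \<beta>"
  have \<beta>\<iota>: "\<beta> (\<iota> k) = k" if "k \<in> V <+> A" for k
    unfolding \<iota>_def using \<beta> that by (simp add: bij_betw_def f_inv_into_f)
  \<comment> \<open>Index the basis of vertices and edges by \<open>\<beta>\<close> and read the graph off the indices; each edge is
    directed from its smaller to its larger end point, as the sign of the bracket demands.\<close>
  define E where "E = {i. \<exists>e. \<beta> i = Inr e}"
  define edge where "edge i = projr (\<beta> i)" for i
  define s where "s i = \<iota> (Inl (Min (edge i)))" for i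
  define r where "r i = \<iota> (Inl (Max (edge i)))" for i
  have edge: "\<beta> k = Inr (edge k) \<and> edge k \<in> A" if "k \<in> E" for k
  proof -
    have "\<beta> k \<in> V <+> A"
      using \<beta> by (auto simp: bij_betw_def)
    then show ?thesis
      using that by (auto simp: E_def edge_def)
  qed
  have ends: "\<beta> (s k) = Inl (Min (edge k)) \<and> \<beta> (r k) = Inl (Max (edge k)) \<and>
      edge k = {Min (edge k), Max (edge k)} \<and> Min (edge k) < Max (edge k)" if k: "k \<in> E" for k
  proof -
    obtain p q where "edge k = {p, q}" "p < q"
      using A edge[OF k] by (metis card_2_iff insert_commute neqE)
    moreover from this have "p \<in> V" "q \<in> V"
      using A edge[OF k] by auto
    ultimately show ?thesis
      by (simp add: s_def r_def \<beta>\<iota> InlI min_def max_def less_imp_le)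
  qed
  have coords: "edge_bracket E s r (\<chi> i. x (\<beta> i)) (\<chi> i. y (\<beta> i)) $ i = graph_bracket V A x y (\<beta> i)"
    for x y i
  proof (cases "i \<in> E")
    case True
    then show ?thesis
      using ends[OF True] edge[OF True]
        graph_bracket_apply(2)[OF assms(1,2), of "edge i" "Min (edge i)" "Max (edge i)" x y]
      by (simp add: edge_bracket_def)
  next
    case False
    then obtain v where "\<beta> i = Inl v"
      by (cases "\<beta> i") (auto simp: E_def)
    then show ?thesis
      using False by (simp add: edge_bracket_def graph_bracket_apply(1)[OF assms(1,2)])
  qed
  obtain Q where Q: "invertible Q" "edge_bracket E s r = gl_act Q \<mu>"
    using graph_bracket_in_coordinates[OF \<beta> basis coords] .
  have in_E: "i \<in> E \<longleftrightarrow> (\<exists>e. \<beta> i = Inr e)" for i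
    by (simp add: E_def)
  have ends': "s k \<noteq> r k \<and> s k \<notin> E \<and> r k \<notin> E" if "k \<in> E" for k
    using ends[OF that] by (metis in_E Inl_Inr_False less_irrefl sum.inject(1))
  have rigid': "two_rigid (edge_bracket E s r)"
    using two_rigid_gl_act[OF rigid Q(1)] edge_bracket_nil2[of E s r] ends' Q(2) by simp
  show False
  proof (cases "A = {}")
    case True
    then have "E = {}"
      using edge by blast
    then show False
      using edgeless_bracket_not_rigid[of E s r] rigid' assms(4,5) by simp
  next
    case False
    obtain u w e where uw: "u \<in> V" "w \<in> V" "u \<noteq> w" "{u, w} \<notin> A" and e: "e \<in> A" "e \<inter> {u, w} = {}"
      using disjoint_nonedge_and_edge[OF assms(2-4) False] .
    have \<beta>s: "\<beta> (\<iota> (Inl u)) = Inl u" "\<beta> (\<iota> (Inl w)) = Inl w" "\<beta> (\<iota> (Inr e)) = Inr e"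
      using uw e by (auto intro!: \<beta>\<iota>)
    have ends_image: "\<beta> ` {s k, r k} = Inl ` edge k" if "k \<in> E" for k
      using ends[OF that] by (metis image_empty image_insert)
    have "\<not> two_rigid (edge_bracket E s r)"
    proof (rule edge_bracket_not_rigid[OF ends', where u = "\<iota> (Inl u)" and w = "\<iota> (Inl w)"
          and z = "\<iota> (Inr e)"])
      show "k = k'" if "k \<in> E" "k' \<in> E" "{s k, r k} = {s k', r k'}" for k k'
      proof -
        have "edge k = edge k'"
          using ends_image[OF that(1)] ends_image[OF that(2)] that(3)
          by (metis inj_Inl inj_image_eq_iff)
        then show ?thesis
          using edge[OF that(1)] edge[OF that(2)] \<beta> by (metis bij_betw_def injD)
      qed
      show "\<iota> (Inl u) \<noteq> \<iota> (Inl w)" "\<iota> (Inl u) \<notin> E" "\<iota> (Inl w) \<notin> E" "\<iota> (Inr e) \<in> E"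
        using \<beta>s uw(3) by (auto simp: in_E)
      show "{s k, r k} \<noteq> {\<iota> (Inl u), \<iota> (Inl w)}" if "k \<in> E" for k
      proof
        assume "{s k, r k} = {\<iota> (Inl u), \<iota> (Inl w)}"
        then have "Inl ` edge k = (Inl ` {u, w} :: ('a + 'a set) set)"
          using ends_image[OF that] \<beta>s by simp
        then have "edge k = {u, w}"
          by (metis inj_Inl inj_image_eq_iff)
        then show False
          using edge[OF that] uw(4) by simp
      qed
      show "{s (\<iota> (Inr e)), r (\<iota> (Inr e))} \<inter> {\<iota> (Inl u), \<iota> (Inl w)} = {}"
      proof -
        have k: "\<iota> (Inr e) \<in> E" and "edge (\<iota> (Inr e)) = e"
          using \<beta>s by (auto simp: in_E edge_def)
        then have "\<beta> ` {s (\<iota> (Inr e)), r (\<iota> (Inr e))} \<inter> {Inl u, Inl w} = {}"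
          using ends_image[OF k] e(2) by auto
        then show ?thesis
          using \<beta>s by auto
      qed
    qed
    then show False
      using rigid' by simp
  qed
qed

end
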